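(* Let $n$ be a positive integer. There exists a bijection $\varphi:\Pi_n\to\Sigma_{n^2}$ such that for all $P,Q\in\Pi_n$, the matrices $P$ and $Q$ are disjoint if and only if $\varphi(P)$ and $\varphi(Q)$ are disjoint.
   Context: For a positive integer $n$, let $\Pi_n$ denote the set of all $(2n)\times n$ matrices in which every row is a permutation of all elements of $\{1,2,\ldots,n\}$. Two matrices $C=(c_{ij}),D=(d_{ij})\in\Pi_n$ are called disjoint if there are no $s,t\in\{1,\ldots,n\}$ such that the ordered pair $\langle c_{st},c_{n+t,\,s}\rangle$ equals the ordered pair $\langle d_{st},d_{n+t,\,s}\rangle$. An $n^2\times n^2$ binary (0/1) matrix $A$ is divided by $n-1$ horizontal and $n-1$ vertical lines into $n^2$ non-intersecting $n\times n$ blocks $A_{kl}$, $1\le k,l\le n$, where $A_{kl}$ consists of rows $(k-1)n+1,\ldots,kn$ and columns $(l-1)n+1,\ldots,ln$ of $A$. Such an $A$ is called an S-permutation matrix if each row, each column, and each block $A_{kl}$ contains exactly one entry equal to $1$. $\Sigma_{n^2}$ denotes the set of all $n^2\times n^2$ S-permutation matrices. Two matrices $A=(a_{ij}),B=(b_{ij})\in\Sigma_{n^2}$ are called disjoint if there are no indices $i,j$ with $a_{ij}=b_{ij}=1$. *)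

theory Defs
  imports "Jordan_Normal_Form.Matrix"
begin

text \<open>
  Matrix indices start at 0, so the paper's entry in row i and column j sits at position
  (i - 1, j - 1). The entries themselves are not shifted: they range over 1, ..., n.
\<close>

definition Pi_mats :: "nat \<Rightarrow> nat mat set" where
  "Pi_mats n = {C \<in> carrier_mat (2 * n) n.
     \<forall>i<2 * n. bij_betw (\<lambda>j. C $$ (i, j)) {..<n} {1..n}}"

definition Pi_disjoint :: "nat \<Rightarrow> nat mat \<Rightarrow> nat mat \<Rightarrow> bool" where
  "Pi_disjoint n C D \<longleftrightarrow>
     \<not> (\<exists>s<n. \<exists>t<n. (C $$ (s, t), C $$ (n + t, s)) = (D $$ (s, t), D $$ (n + t, s)))"

definition block :: "nat \<Rightarrow> 'a mat \<Rightarrow> nat \<Rightarrow> nat \<Rightarrow> 'a mat" where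
  "block n A k l = mat n n (\<lambda>(i, j). A $$ (k * n + i, l * n + j))"

definition binary_mat :: "nat mat \<Rightarrow> bool" where
  "binary_mat A \<longleftrightarrow> elements_mat A \<subseteq> {0, 1}"

definition S_perm_mats :: "nat \<Rightarrow> nat mat set" where
  "S_perm_mats n = {A \<in> carrier_mat (n\<^sup>2) (n\<^sup>2). binary_mat A \<and>
     (\<forall>i<n\<^sup>2. \<exists>!j. j < n\<^sup>2 \<and> A $$ (i, j) = 1) \<and>
     (\<forall>j<n\<^sup>2. \<exists>!i. i < n\<^sup>2 \<and> A $$ (i, j) = 1) \<and>
     (\<forall>k<n. \<forall>l<n. \<exists>!p. p \<in> {..<n} \<times> {..<n} \<and> block n A k l $$ p = 1)}"

definition S_disjoint :: "nat \<Rightarrow> nat mat \<Rightarrow> nat mat \<Rightarrow> bool" where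
  "S_disjoint n A B \<longleftrightarrow> \<not> (\<exists>i<n\<^sup>2. \<exists>j<n\<^sup>2. A $$ (i, j) = 1 \<and> B $$ (i, j) = 1)"

end

theory Submission
  imports Defs
begin

text \<open>
  An S-permutation matrix is determined by the positions of its ones inside the blocks.
  A matrix C in Pi encodes the position inside block (s, t) by the pair (C(s, t), C(n + t, s)).
  Row s of the upper half of C then lists the in-block row indices of the ones along block row s,
  and this list is a permutation precisely because every row of the big matrix has a single one;
  the lower half does the same for columns. Matrices in Pi are disjoint iff no block has its one
  at the same position in both images.
\<close>

definition S_of_Pi :: "nat \<Rightarrow> nat mat \<Rightarrow> nat mat" where
  "S_of_Pi n C = mat (n\<^sup>2) (n\<^sup>2) (\<lambda>(i, j).
     if C $$ (i div n, j div n) = Suc (i mod n) \<and> C $$ (n + j div n, i div n) = Suc (j mod n)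
     then 1 else 0)"

lemma block_index_less:
  fixes k i n :: nat
  assumes "k < n" "i < n"
  shows "k * n + i < n\<^sup>2"
proof -
  have "k * n + i < Suc k * n" using assms by simp
  also have "\<dots> \<le> n * n" using assms by (intro mult_le_mono) auto
  finally show ?thesis by (simp add: power2_eq_square)
qed

lemma div_less_of_less_square:
  fixes i n :: nat
  assumes "i < n\<^sup>2"
  shows "i div n < n"
  using assms by (simp add: power2_eq_square less_mult_imp_div_less)

lemma mod_less_of_less_square:
  fixes i n :: nat
  assumes "i < n\<^sup>2"
  shows "i mod n < n"
  using assms by (cases "n = 0") auto

lemma Pi_mats_bound:
  assumes "C \<in> Pi_mats n" "i < 2 * n" "j < n"
  shows "1 \<le> C $$ (i, j)" "C $$ (i, j) \<le> n"
proof -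
  have "C $$ (i, j) \<in> {1..n}"
    using assms bij_betwE[of "\<lambda>j. C $$ (i, j)" "{..<n}" "{1..n}"] unfolding Pi_mats_def by auto
  then show "1 \<le> C $$ (i, j)" "C $$ (i, j) \<le> n" by auto
qed

text \<open>Entries range over 1, ..., n, while offsets inside a block start at 0. Writing an entry
  as \<open>Suc a\<close> yields the offset \<open>a\<close> together with its bound.\<close>

lemma Pi_mats_entry:
  assumes "C \<in> Pi_mats n" "i < 2 * n" "j < n"
  obtains a where "a < n" "C $$ (i, j) = Suc a"
  using Pi_mats_bound[OF assms] by (cases "C $$ (i, j)") auto

text \<open>This locates ones of the big matrix: for \<open>i < n\<close> it singles out a block
  column, for \<open>i \<ge> n\<close> a block row.\<close>

lemma Pi_mats_ex1:
  assumes "C \<in> Pi_mats n" "i < 2 * n" "a < n"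
  shows "\<exists>!j. j < n \<and> C $$ (i, j) = Suc a"
proof -
  have bij: "bij_betw (\<lambda>j. C $$ (i, j)) {..<n} {1..n}"
    using assms unfolding Pi_mats_def by auto
  have "Suc a \<in> {1..n}" using assms by auto
  then have "Suc a \<in> (\<lambda>j. C $$ (i, j)) ` {..<n}"
    using bij_betw_imp_surj_on[OF bij] by simp
  then obtain j where "j < n" "C $$ (i, j) = Suc a"
    by auto
  with bij_betw_imp_inj_on[OF bij] show ?thesis
    unfolding inj_on_def by (metis lessThan_iff)
qed

text \<open>Stated with \<open>Suc 0\<close> because the simplifier rewrites the natural number 1 to
  it; in this form the equivalence fires as a rewrite rule.\<close>

lemma S_of_Pi_eq_1:
  assumes "i < n\<^sup>2" "j < n\<^sup>2"
  shows "S_of_Pi n C $$ (i, j) = Suc 0 \<longleftrightarrow>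
    C $$ (i div n, j div n) = Suc (i mod n) \<and> C $$ (n + j div n, i div n) = Suc (j mod n)"
  using assms by (simp add: S_of_Pi_def)

lemma S_of_Pi_block_eq_1:
  assumes "k < n" "l < n" "i < n" "j < n"
  shows "S_of_Pi n C $$ (k * n + i, l * n + j) = Suc 0 \<longleftrightarrow>
    C $$ (k, l) = Suc i \<and> C $$ (n + l, k) = Suc j"
  using assms by (simp add: S_of_Pi_eq_1 block_index_less)

lemma S_of_Pi_in_S_perm_mats:
  assumes C: "C \<in> Pi_mats n"
  shows "S_of_Pi n C \<in> S_perm_mats n"
proof -
  have row: "\<exists>!j. j < n\<^sup>2 \<and> S_of_Pi n C $$ (i, j) = 1" if i: "i < n\<^sup>2" for i
  proof -
    note i' = div_less_of_less_square[OF i] mod_less_of_less_square[OF i]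
    \<comment> \<open>The upper row \<open>i div n\<close> of \<open>C\<close> contains
      \<open>Suc (i mod n)\<close> exactly once, which fixes the block column \<open>t\<close> of
      the one in row \<open>i\<close>. The lower half then supplies its column offset
      \<open>b\<close>.\<close>
    obtain t where t: "t < n" "C $$ (i div n, t) = Suc (i mod n)"
      and t_unique: "\<And>t'. t' < n \<Longrightarrow> C $$ (i div n, t') = Suc (i mod n) \<Longrightarrow> t' = t"
      using Pi_mats_ex1[OF C _ i'(2), of "i div n"] i'(1) by auto
    obtain b where b: "b < n" "C $$ (n + t, i div n) = Suc b"
      using Pi_mats_entry[OF C, of "n + t" "i div n"] t(1) i'(1) by auto
    show ?thesis
    proof (rule ex1I[of _ "t * n + b"])
      show "t * n + b < n\<^sup>2 \<and> S_of_Pi n C $$ (i, t * n + b) = 1"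
        using t b i block_index_less[OF t(1) b(1)] by (simp add: S_of_Pi_eq_1)
    next
      fix j assume j: "j < n\<^sup>2 \<and> S_of_Pi n C $$ (i, j) = 1"
      then have eq: "C $$ (i div n, j div n) = Suc (i mod n)"
        "C $$ (n + j div n, i div n) = Suc (j mod n)"
        using S_of_Pi_eq_1[OF i] by auto
      have "j div n = t" using t_unique eq(1) j div_less_of_less_square by blast
      moreover from this have "j mod n = b" using eq(2) b by simp
      ultimately show "j = t * n + b" by (metis div_mult_mod_eq)
    qed
  qed
  have col: "\<exists>!i. i < n\<^sup>2 \<and> S_of_Pi n C $$ (i, j) = 1" if j: "j < n\<^sup>2" for j
  proof -
    note j' = div_less_of_less_square[OF j] mod_less_of_less_square[OF j]
    \<comment> \<open>Dually, the lower row \<open>n + j div n\<close> fixes the block row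
      \<open>s\<close>, and the upper half supplies the row offset \<open>a\<close>.\<close>
    obtain s where s: "s < n" "C $$ (n + j div n, s) = Suc (j mod n)"
      and s_unique: "\<And>s'. s' < n \<Longrightarrow> C $$ (n + j div n, s') = Suc (j mod n) \<Longrightarrow> s' = s"
      using Pi_mats_ex1[OF C _ j'(2), of "n + j div n"] j'(1) by auto
    obtain a where a: "a < n" "C $$ (s, j div n) = Suc a"
      using Pi_mats_entry[OF C, of s "j div n"] s(1) j'(1) by auto
    show ?thesis
    proof (rule ex1I[of _ "s * n + a"])
      show "s * n + a < n\<^sup>2 \<and> S_of_Pi n C $$ (s * n + a, j) = 1"
        using s a j block_index_less[OF s(1) a(1)] by (simp add: S_of_Pi_eq_1)
    next
      fix i assume i: "i < n\<^sup>2 \<and> S_of_Pi n C $$ (i, j) = 1"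
      then have eq: "C $$ (i div n, j div n) = Suc (i mod n)"
        "C $$ (n + j div n, i div n) = Suc (j mod n)"
        using S_of_Pi_eq_1[OF _ j] by auto
      have "i div n = s" using s_unique eq(2) i div_less_of_less_square by blast
      moreover from this have "i mod n = a" using eq(1) a by simp
      ultimately show "i = s * n + a" by (metis div_mult_mod_eq)
    qed
  qed
  have blk: "\<exists>!p. p \<in> {..<n} \<times> {..<n} \<and> block n (S_of_Pi n C) k l $$ p = 1"
    if kl: "k < n" "l < n" for k l
  proof -
    obtain a where a: "a < n" "C $$ (k, l) = Suc a"
      using Pi_mats_entry[OF C, of k l] kl by auto
    obtain b where b: "b < n" "C $$ (n + l, k) = Suc b"
      using Pi_mats_entry[OF C, of "n + l" k] kl by auto
    show ?thesis
      by (rule ex1I[of _ "(a, b)"]) (use a b kl in \<open>auto simp: block_def S_of_Pi_block_eq_1\<close>)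
  qed
  have "binary_mat (S_of_Pi n C)"
    unfolding binary_mat_def elements_mat_def by (auto simp: S_of_Pi_def)
  moreover have "S_of_Pi n C \<in> carrier_mat (n\<^sup>2) (n\<^sup>2)" by (simp add: S_of_Pi_def)
  ultimately show ?thesis using row col blk unfolding S_perm_mats_def mem_Collect_eq
    by (intro conjI allI impI)
qed

text \<open>A common one at (i, j) forces both pairs for its block to be
  \<open>(Suc (i mod n), Suc (j mod n))\<close>. Conversely, a common pair at (s, t) puts a one at
  the same position of block (s, t) in both images.\<close>

lemma S_disjoint_S_of_Pi:
  assumes C: "C \<in> Pi_mats n"
  shows "S_disjoint n (S_of_Pi n C) (S_of_Pi n D) \<longleftrightarrow> Pi_disjoint n C D"
proof -
  have "(\<exists>i<n\<^sup>2. \<exists>j<n\<^sup>2. S_of_Pi n C $$ (i, j) = 1 \<and> S_of_Pi n D $$ (i, j) = 1) \<longleftrightarrow>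
    (\<exists>s<n. \<exists>t<n. C $$ (s, t) = D $$ (s, t) \<and> C $$ (n + t, s) = D $$ (n + t, s))"
    (is "?L \<longleftrightarrow> ?R")
  proof
    assume ?L
    then obtain i j where ij: "i < n\<^sup>2" "j < n\<^sup>2"
      "S_of_Pi n C $$ (i, j) = 1" "S_of_Pi n D $$ (i, j) = 1" by blast
    then have "C $$ (i div n, j div n) = D $$ (i div n, j div n)"
      "C $$ (n + j div n, i div n) = D $$ (n + j div n, i div n)"
      by (simp_all add: S_of_Pi_eq_1)
    then show ?R
      using div_less_of_less_square[OF ij(1)] div_less_of_less_square[OF ij(2)] by blast
  next
    assume ?R
    then obtain s t where st: "s < n" "t < n"
      "C $$ (s, t) = D $$ (s, t)" "C $$ (n + t, s) = D $$ (n + t, s)" by blast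
    obtain a where a: "a < n" "C $$ (s, t) = Suc a"
      using Pi_mats_entry[OF C, of s t] st by auto
    obtain b where b: "b < n" "C $$ (n + t, s) = Suc b"
      using Pi_mats_entry[OF C, of "n + t" s] st by auto
    have "S_of_Pi n C $$ (s * n + a, t * n + b) = 1" "S_of_Pi n D $$ (s * n + a, t * n + b) = 1"
      using st a b by (simp_all add: S_of_Pi_block_eq_1)
    then show ?L
      using block_index_less[OF st(1) a(1)] block_index_less[OF st(2) b(1)] by blast
  qed
  then show ?thesis unfolding S_disjoint_def Pi_disjoint_def by simp
qed

lemma inj_on_S_of_Pi: "inj_on (S_of_Pi n) (Pi_mats n)"
proof (rule inj_onI)
  fix C D assume C: "C \<in> Pi_mats n" and D: "D \<in> Pi_mats n" and eq: "S_of_Pi n C = S_of_Pi n D"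
  have agree: "C $$ (s, t) = D $$ (s, t) \<and> C $$ (n + t, s) = D $$ (n + t, s)"
    if st: "s < n" "t < n" for s t
  proof -
    obtain a where a: "a < n" "C $$ (s, t) = Suc a"
      using Pi_mats_entry[OF C, of s t] st by auto
    obtain b where b: "b < n" "C $$ (n + t, s) = Suc b"
      using Pi_mats_entry[OF C, of "n + t" s] st by auto
    \<comment> \<open>The one that \<open>C\<close> places in block (s, t) is also a one of the
      image of \<open>D\<close>, so the pair of \<open>D\<close> can be read off from its
      position.\<close>
    have "S_of_Pi n D $$ (s * n + a, t * n + b) = 1"
      unfolding eq[symmetric] using st a b by (simp add: S_of_Pi_block_eq_1)
    then show ?thesis using st a b by (simp add: S_of_Pi_block_eq_1)
  qed
  show "C = D"
  proof (rule eq_matI)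
    fix i j assume "i < dim_row D" "j < dim_col D"
    then have ij: "i < 2 * n" "j < n" using D unfolding Pi_mats_def by auto
    show "C $$ (i, j) = D $$ (i, j)"
    proof (cases "i < n")
      case True
      then show ?thesis using agree ij by blast
    next
      case False
      \<comment> \<open>The lower half is indexed with the roles swapped: entry (i, j) belongs to
        block (j, i - n).\<close>
      then have "i - n < n" "n + (i - n) = i" using ij by auto
      then show ?thesis using agree[OF ij(2), of "i - n"] by simp
    qed
  qed (use C D in \<open>auto simp: Pi_mats_def\<close>)
qed

text \<open>The preimage is built by recording, for each block (k, l), the position
  \<open>p k l\<close> of its only one.\<close>

lemma S_of_Pi_surj:
  assumes A: "A \<in> S_perm_mats n"
  shows "\<exists>C\<in>Pi_mats n. S_of_Pi n C = A"
proof -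
  have carr: "A \<in> carrier_mat (n\<^sup>2) (n\<^sup>2)" and bin: "binary_mat A"
    and row: "\<And>i. i < n\<^sup>2 \<Longrightarrow> \<exists>!j. j < n\<^sup>2 \<and> A $$ (i, j) = 1"
    and col: "\<And>j. j < n\<^sup>2 \<Longrightarrow> \<exists>!i. i < n\<^sup>2 \<and> A $$ (i, j) = 1"
    and blk: "\<And>k l. k < n \<Longrightarrow> l < n \<Longrightarrow> \<exists>!p. p \<in> {..<n} \<times> {..<n} \<and> block n A k l $$ p = 1"
    using A unfolding S_perm_mats_def by auto
  have "\<exists>p. fst p < n \<and> snd p < n \<and>
      (\<forall>i<n. \<forall>j<n. A $$ (k * n + i, l * n + j) = 1 \<longleftrightarrow> p = (i, j))"
    if kl: "k < n" "l < n" for k l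
  proof -
    obtain p where p: "p \<in> {..<n} \<times> {..<n}" "block n A k l $$ p = 1"
      and unique: "\<And>q. q \<in> {..<n} \<times> {..<n} \<Longrightarrow> block n A k l $$ q = 1 \<Longrightarrow> q = p"
      using blk[OF kl] by blast
    have "A $$ (k * n + i, l * n + j) = 1 \<longleftrightarrow> p = (i, j)" if "i < n" "j < n" for i j
      using p unique[of "(i, j)"] that by (auto simp: block_def)
    with p(1) show ?thesis by (intro exI[of _ p]) auto
  qed
  then obtain p where p: "\<And>k l. k < n \<Longrightarrow> l < n \<Longrightarrow> fst (p k l) < n \<and> snd (p k l) < n \<and>
      (\<forall>i<n. \<forall>j<n. A $$ (k * n + i, l * n + j) = 1 \<longleftrightarrow> p k l = (i, j))"
    by metis
  have p_less: "fst (p k l) < n" "snd (p k l) < n" if "k < n" "l < n" for k l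
    using p[OF that] by blast+
  have p_iff: "A $$ (k * n + i, l * n + j) = 1 \<longleftrightarrow> p k l = (i, j)"
    if "k < n" "l < n" "i < n" "j < n" for k l i j
    using p[OF that(1,2)] that(3,4) by blast
  have one: "A $$ (k * n + fst (p k l), l * n + snd (p k l)) = 1" if "k < n" "l < n" for k l
    using p_iff p_less that by simp
  define C where "C = mat (2 * n) n (\<lambda>(i, j).
    if i < n then Suc (fst (p i j)) else Suc (snd (p j (i - n))))"
  \<comment> \<open>Two blocks in block row \<open>s\<close> with equal row offsets would have their
    ones in the same row of \<open>A\<close>. These ones then coincide, and division by
    \<open>n\<close> gives equal block columns.\<close>
  have inj_fst: "inj_on (\<lambda>t. fst (p s t)) {..<n}" if s: "s < n" for s
  proof (rule inj_onI)
    fix t t' assume t: "t \<in> {..<n}" "t' \<in> {..<n}" and eq: "fst (p s t) = fst (p s t')"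
    have "t * n + snd (p s t) < n\<^sup>2" "t' * n + snd (p s t') < n\<^sup>2"
      "s * n + fst (p s t) < n\<^sup>2"
      using s t by (auto intro!: block_index_less p_less)
    moreover have "A $$ (s * n + fst (p s t), t' * n + snd (p s t')) = 1"
      using one[of s t'] s t eq by simp
    ultimately have "t * n + snd (p s t) = t' * n + snd (p s t')"
      using row one[of s t] s t by blast
    from arg_cong[OF this, of "\<lambda>x. x div n"] show "t = t'"
      using s t p_less by simp
  qed
  \<comment> \<open>The same argument with columns of \<open>A\<close> in place of rows.\<close>
  have inj_snd: "inj_on (\<lambda>s. snd (p s t)) {..<n}" if t: "t < n" for t
  proof (rule inj_onI)
    fix s s' assume s: "s \<in> {..<n}" "s' \<in> {..<n}" and eq: "snd (p s t) = snd (p s' t)"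
    have "s * n + fst (p s t) < n\<^sup>2" "s' * n + fst (p s' t) < n\<^sup>2"
      "t * n + snd (p s t) < n\<^sup>2"
      using s t by (auto intro!: block_index_less p_less)
    moreover have "A $$ (s' * n + fst (p s' t), t * n + snd (p s t)) = 1"
      using one[of s' t] s t eq by simp
    ultimately have "s * n + fst (p s t) = s' * n + fst (p s' t)"
      using col one[of s t] s t by blast
    from arg_cong[OF this, of "\<lambda>x. x div n"] show "s = s'"
      using s t p_less by simp
  qed
  have "bij_betw (\<lambda>j. C $$ (i, j)) {..<n} {1..n}" if i: "i < 2 * n" for i
  proof -
    have inj: "inj_on (\<lambda>j. C $$ (i, j)) {..<n}"
    proof (cases "i < n")
      case True
      then show ?thesis using inj_fst[OF True] by (simp add: C_def inj_on_def)
    next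
      case False
      then have "i - n < n" using i by simp
      from inj_snd[OF this] show ?thesis using False i by (simp add: C_def inj_on_def)
    qed
    \<comment> \<open>An injection of \<open>{..<n}\<close> into \<open>{1..n}\<close> is onto, as
      both sets have \<open>n\<close> elements.\<close>
    moreover have "(\<lambda>j. C $$ (i, j)) ` {..<n} \<subseteq> {1..n}"
      using i p_less by (auto simp: C_def Suc_le_eq)
    ultimately show ?thesis
      unfolding bij_betw_def by (simp add: card_subset_eq card_image)
  qed
  then have "C \<in> Pi_mats n" unfolding Pi_mats_def by (simp add: C_def)
  moreover have "S_of_Pi n C = A"
  proof (rule eq_matI)
    fix i j assume "i < dim_row A" "j < dim_col A"
    then have ij: "i < n\<^sup>2" "j < n\<^sup>2" using carr by auto
    note b = div_less_of_less_square[OF ij(1)] mod_less_of_less_square[OF ij(1)]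
      div_less_of_less_square[OF ij(2)] mod_less_of_less_square[OF ij(2)]
    have "A $$ (i, j) = 1 \<longleftrightarrow> p (i div n) (j div n) = (i mod n, j mod n)"
      using p_iff[OF b(1,3,2,4)] by simp
    then have "S_of_Pi n C $$ (i, j) = 1 \<longleftrightarrow> A $$ (i, j) = 1"
      using ij b by (simp add: S_of_Pi_eq_1 C_def prod_eq_iff)
    \<comment> \<open>Both matrices have entries in {0, 1}, so having their ones in the same places
      makes them equal.\<close>
    moreover have "A $$ (i, j) \<in> {0, 1}"
      using bin carr ij unfolding binary_mat_def by auto
    moreover have "S_of_Pi n C $$ (i, j) \<in> {0, 1}"
      using ij by (simp add: S_of_Pi_def)
    ultimately show "S_of_Pi n C $$ (i, j) = A $$ (i, j)" by auto
  qed (use carr in \<open>auto simp: S_of_Pi_def\<close>)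
  ultimately show ?thesis by blast
qed

theorem theorem1:
  fixes n :: nat
  assumes "n > 0"
  shows "\<exists>\<phi>. bij_betw \<phi> (Pi_mats n) (S_perm_mats n) \<and>
    (\<forall>P\<in>Pi_mats n. \<forall>Q\<in>Pi_mats n. Pi_disjoint n P Q \<longleftrightarrow> S_disjoint n (\<phi> P) (\<phi> Q))"
proof (intro exI[of _ "S_of_Pi n"] conjI ballI)
  show "bij_betw (S_of_Pi n) (Pi_mats n) (S_perm_mats n)"
    unfolding bij_betw_def using inj_on_S_of_Pi S_of_Pi_in_S_perm_mats S_of_Pi_surj by blast
qed (simp add: S_disjoint_S_of_Pi)

end
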